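(* Let $\theta>0$ and $F_\theta=I_n+\sum_{i\in\pi_k^a}\big(\frac{\theta}{\lambda_i}-1\big)s_is_i^\top$. Let $x_\ell^{D}$ denote the deflated CG iterate $$x_\ell^{D}=\sum_{i\in\pi_k^a}\frac1{\lambda_i}s_is_i^\top b+Pz_\ell .$$ Then $$\|x^\ast-x_\ell^{D}\|_A\le\|x^\ast-\hat x_\ell(F_\theta)\|_A\le\frac{\alpha(\theta)}{\theta}\,\|x^\ast-x_{\ell-1}^{D}\|_A,$$ with $\alpha(\theta)=\max\big(|\lambda_{j_0}-\theta|,\,|\theta-\lambda_{n-k+j_0-1}|\big)$.
   Context: $A\in\mathbb{R}^{n\times n}$ is symmetric positive definite with spectral decomposition $A=S\Lambda S^\top$, $\Lambda=\mathrm{diag}(\lambda_1,\dots,\lambda_n)$, $\lambda_1\ge\dots\ge\lambda_n>0$, $S=[s_1\ \cdots\ s_n]$ orthogonal. $b\in\mathbb{R}^n$, $x^\ast=A^{-1}b$, $x_0\in\mathbb{R}^n$ is an initial guess. $\|x\|_A=\sqrt{x^\top A x}$. $k$ is an integer with $1<k<n$. A bar over a subset of $\{1,\dots,n\}$ denotes its complement. Exact arithmetic is assumed. $j_0\in\arg\min_{1\le j\le k+1}\lambda_j/\lambda_{n-k+j-1}$, and $\pi_k^a\subset\{1,\dots,n\}$ is the set of $k$ indices with $\bar\pi_k^a=\{j_0,j_0+1,\dots,n-k+j_0-1\}$. Feasible preconditioner: $F=I_n+SDS^\top$ with $D=\mathrm{diag}(d_1,\dots,d_n)$ real, $I_n+D$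 positive definite and $\mathrm{rank}(D)\le k$. $\mathbf{PCG}(F)$ is the preconditioned conjugate gradient method for $Ax=b$ with preconditioner $F$: $\hat x_0=x_0$, $\hat r_0=b-A\hat x_0$, $z_0=F\hat r_0$, $\hat\rho_0=\hat r_0^\top z_0$, $\hat p_0=z_0$, and for $\ell=0,1,\dots$: $\hat q_\ell=A\hat p_\ell$, $\hat\alpha_\ell=\hat\rho_\ell/(\hat q_\ell^\top\hat p_\ell)$, $\hat x_{\ell+1}=\hat x_\ell+\hat\alpha_\ell\hat p_\ell$, $\hat r_{\ell+1}=\hat r_\ell-\hat\alpha_\ell\hat q_\ell$, $z_{\ell+1}=F\hat r_{\ell+1}$, $\hat\rho_{\ell+1}=\hat r_{\ell+1}^\top z_{\ell+1}$, $\hat\beta_{\ell+1}=\hat\rho_{\ell+1}/\hat\rho_\ell$, $\hat p_{\ell+1}=z_{\ell+1}+\hat\beta_{\ell+1}\hat p_\ell$; it stops once the solution is reached. $\hat x_\ell(F)$ denotes its $\ell$-th iterate. The same recurrences with $F=I_n$ define CG, also for a consistent system with symmetric positive semidefinite matrix. In the definition of $x_\ell^{D}$: $P=I_n-\sum_{i\in\pi_k^a}s_is_i^\top$, and $z_\ell$ is the $\ell$-th iterate of CG applied to the consistent system $PAz=Pb$ starting from $z_0=x_0$ (not to be confused with the $z_\ell$ in the PCG recurrences). Standing assumption: $\ell\ge1$ is fixed and, for every feasible $F$, $\mathbf{PCG}(F)$ has not reached the solution at iteration $\ell$ (the iterates up to $\ell$ are defined and $\hat x_j(F)\ne x^\ast$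 for $j\le\ell$). *)

theory Defs
  imports "HOL-Analysis.Analysis"
begin

definition spd :: "real^'n^'n \<Rightarrow> bool" where
  "spd A \<longleftrightarrow> transpose A = A \<and> (\<forall>x. x \<noteq> 0 \<longrightarrow> x \<bullet> (A *v x) > 0)"

definition anorm :: "real^'n^'n \<Rightarrow> real^'n \<Rightarrow> real" where
  "anorm A x = sqrt (x \<bullet> (A *v x))"

text \<open>
  The index type \<open>'n\<close> carries no order. Coordinates are numbered \<open>1, \<dots>, n\<close> by a bijection
  \<open>e\<close> from \<open>{1..CARD('n)}\<close> onto \<open>'n\<close>: the \<open>i\<close>-th column of \<open>S\<close> is \<open>column (e i) S\<close>,
  and \<open>diag_mat e d\<close> is the matrix diag(d 1, ..., d n).
\<close>

definition diag_mat :: "(nat \<Rightarrow> 'n) \<Rightarrow> (nat \<Rightarrow> real) \<Rightarrow> real^'n^'n" where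
  "diag_mat e d = (\<chi> i j. if i = j then d (inv_into {1..CARD('n)} e i) else 0)"

lemma diag_mat_nth:
  fixes e :: "nat \<Rightarrow> 'n::finite"
  assumes "bij_betw e {1..CARD('n)} UNIV" "i \<in> {1..CARD('n)}" "j \<in> {1..CARD('n)}"
  shows "diag_mat e d $ e i $ e j = (if i = j then d i else 0)"
proof -
  have "inj_on e {1..CARD('n)}"
    using assms(1) by (rule bij_betw_imp_inj_on)
  then show ?thesis
    using assms(2,3) by (auto simp: diag_mat_def inv_into_f_f dest: inj_onD)
qed

definition outer :: "real^'n \<Rightarrow> real^'n^'n" where
  "outer v = (columnvector v :: real^1^'n) ** (rowvector v :: real^'n^1)"

text \<open>
  Preconditioned conjugate gradients for \<open>M x = c\<close> with preconditioner \<open>F\<close> and initial guess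
  \<open>x0\<close>. The state is the triple (iterate, recursive residual, search direction).
  Stopping needs no separate rule: once the residual is zero, \<open>\<rho> = 0\<close>, hence
  \<open>\<alpha> = 0\<close> (also if its denominator is zero, because \<open>0 / 0 = 0\<close>), and the iterate
  no longer changes; see \<open>pcg_stops\<close> below.
\<close>

primrec pcg :: "real^'n^'n \<Rightarrow> real^'n \<Rightarrow> real^'n^'n \<Rightarrow> real^'n \<Rightarrow> nat
    \<Rightarrow> (real^'n) \<times> (real^'n) \<times> (real^'n)" where
  "pcg M c F x0 0 = (x0, c - M *v x0, F *v (c - M *v x0))"
| "pcg M c F x0 (Suc l) =
    (let (x, r, p) = pcg M c F x0 l;
         \<rho> = r \<bullet> (F *v r);
         q = M *v p;
         \<alpha> = \<rho> / (q \<bullet> p);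
         x' = x + \<alpha> *\<^sub>R p;
         r' = r - \<alpha> *\<^sub>R q;
         z' = F *v r';
         \<rho>' = r' \<bullet> z';
         \<beta> = \<rho>' / \<rho>
     in (x', r', z' + \<beta> *\<^sub>R p))"

definition pcg_x :: "real^'n^'n \<Rightarrow> real^'n \<Rightarrow> real^'n^'n \<Rightarrow> real^'n \<Rightarrow> nat \<Rightarrow> real^'n" where
  "pcg_x M c F x0 l = fst (pcg M c F x0 l)"

definition pcg_r :: "real^'n^'n \<Rightarrow> real^'n \<Rightarrow> real^'n^'n \<Rightarrow> real^'n \<Rightarrow> nat \<Rightarrow> real^'n" where
  "pcg_r M c F x0 l = fst (snd (pcg M c F x0 l))"

definition pcg_p :: "real^'n^'n \<Rightarrow> real^'n \<Rightarrow> real^'n^'n \<Rightarrow> real^'n \<Rightarrow> nat \<Rightarrow> real^'n" where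
  "pcg_p M c F x0 l = snd (snd (pcg M c F x0 l))"

lemma pcg_stops:
  assumes "pcg_r M c F x0 l = 0"
  shows "pcg_x M c F x0 (Suc l) = pcg_x M c F x0 l" "pcg_r M c F x0 (Suc l) = 0"
  using assms by (auto simp: pcg_x_def pcg_r_def Let_def split: prod.splits)

definition cg_x :: "real^'n^'n \<Rightarrow> real^'n \<Rightarrow> real^'n \<Rightarrow> nat \<Rightarrow> real^'n" where
  "cg_x M c x0 l = pcg_x M c (mat 1) x0 l"

text \<open>
  The iterates up to \<open>l\<close> are defined (the denominators of \<open>\<alpha>\<close> in steps \<open>0, \<dots>, l - 1\<close>
  and of \<open>\<beta>\<close> in steps \<open>1, \<dots>, l - 1\<close> do not vanish) and none of them is the solution.
\<close>

definition pcg_not_reached ::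
    "real^'n^'n \<Rightarrow> real^'n \<Rightarrow> real^'n^'n \<Rightarrow> real^'n \<Rightarrow> nat \<Rightarrow> bool" where
  "pcg_not_reached A b F x0 l \<longleftrightarrow>
    (\<forall>j<l. (A *v pcg_p A b F x0 j) \<bullet> pcg_p A b F x0 j \<noteq> 0) \<and>
    (\<forall>j. Suc j < l \<longrightarrow> pcg_r A b F x0 j \<bullet> (F *v pcg_r A b F x0 j) \<noteq> 0) \<and>
    (\<forall>j\<le>l. pcg_x A b F x0 j \<noteq> matrix_inv A *v b)"

definition feasible :: "(nat \<Rightarrow> 'n) \<Rightarrow> real^'n^'n \<Rightarrow> nat \<Rightarrow> real^'n^'n \<Rightarrow> bool" where
  "feasible e S k F \<longleftrightarrow>
    (\<exists>d :: nat \<Rightarrow> real.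
       F = mat 1 + S ** diag_mat e d ** transpose S \<and>
       spd (mat 1 + diag_mat e d) \<and> rank (diag_mat e d) \<le> k)"

definition pi_a :: "nat \<Rightarrow> nat \<Rightarrow> nat \<Rightarrow> nat set" where
  "pi_a n k j0 = {1..n} - {j0..n - k + j0 - 1}"

definition F_theta ::
    "nat set \<Rightarrow> (nat \<Rightarrow> real) \<Rightarrow> (nat \<Rightarrow> real^'n) \<Rightarrow> real \<Rightarrow> real^'n^'n" where
  "F_theta \<pi> lam s \<theta> = mat 1 + (\<Sum>i\<in>\<pi>. (\<theta> / lam i - 1) *\<^sub>R outer (s i))"

definition defl_proj :: "nat set \<Rightarrow> (nat \<Rightarrow> real^'n) \<Rightarrow> real^'n^'n" where
  "defl_proj \<pi> s = mat 1 - (\<Sum>i\<in>\<pi>. outer (s i))"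

definition defl_x :: "real^'n^'n \<Rightarrow> real^'n \<Rightarrow> real^'n \<Rightarrow> nat set \<Rightarrow> (nat \<Rightarrow> real)
    \<Rightarrow> (nat \<Rightarrow> real^'n) \<Rightarrow> nat \<Rightarrow> real^'n" where
  "defl_x A b x0 \<pi> lam s l =
    (\<Sum>i\<in>\<pi>. (1 / lam i) *\<^sub>R (outer (s i) *v b)) +
    defl_proj \<pi> s *v cg_x (defl_proj \<pi> s ** A) (defl_proj \<pi> s *v b) x0 l"

end

theory Submission
  imports Defs
begin

text \<open>
  The \<open>l\<close>-th iterate of preconditioned conjugate gradients for \<open>M x = M xs\<close>, with \<open>M\<close>
  symmetric positive semidefinite, minimises the \<open>M\<close>-seminorm of the error over \<open>x0\<close> plus the
  Krylov space of \<open>F M\<close> (\<open>pcg_optimal\<close>, \<open>pcg_in_krylov\<close>). In other words its error is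
  \<open>q(F M) (xs - x0)\<close> for the best polynomial \<open>q\<close> of degree at most \<open>l\<close> with \<open>q(0) = 1\<close>. This
  covers both methods: the shifted one has \<open>M = A\<close> and \<open>F = F_theta\<close>, the deflated one has
  \<open>M = P A\<close> and \<open>F = 1\<close>, and the \<open>P A\<close>-seminorm of the inner error is the \<open>A\<close>-norm of the
  deflated error (\<open>deflated_error\<close>).

  All matrices involved are diagonal in the eigenbasis of \<open>A\<close>. On the eigenvectors outside \<open>\<pi>\<close>,
  \<open>F_theta A\<close> and \<open>P A\<close> both have the eigenvalues of \<open>A\<close>; on those in \<open>\<pi>\<close>, \<open>F_theta A\<close> is
  \<open>\<theta>\<close> and \<open>P A\<close> is \<open>0\<close>. Two choices of the polynomial then give the two inequalities
  (\<open>deflated_shifted_cg\<close>):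

  For the first, the polynomial that is optimal for the shifted method competes in the deflated
  one. The error obtained there is the shifted error without its components in \<open>\<pi>\<close>, so its norm is
  not larger.

  For the second, let \<open>q\<close> be optimal for the deflated method after \<open>l - 1\<close> steps. The polynomial
  \<open>(1 - t / \<theta>) q(t)\<close> competes in step \<open>l\<close> of the shifted method. Its first factor annihilates the
  components in \<open>\<pi>\<close> and multiplies each other component by \<open>1 - \<lambda>\<^sub>i / \<theta>\<close>, which is at most
  \<open>\<alpha>(\<theta>) / \<theta>\<close> in modulus because the eigenvalues outside \<open>\<pi>\<close> lie between \<open>\<lambda>\<close> at the two ends of
  the complement of \<open>\<pi>\<close>.

  Polynomials do not occur explicitly below: \<open>q(T) e\<close> with \<open>q(0) = 1\<close> and degree at most \<open>l\<close> is
  \<open>e - d\<close> with \<open>d\<close> in the Krylov space of order \<open>l\<close> generated by \<open>T e\<close>.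
\<close>

section \<open>Krylov spaces\<close>

definition krylov :: "real^'n^'n \<Rightarrow> real^'n \<Rightarrow> nat \<Rightarrow> (real^'n) set" where
  "krylov T v l = span ((\<lambda>j. (((*v) T) ^^ j) v) ` {..<l})"

lemma subspace_krylov: "subspace (krylov T v l)"
  by (simp add: krylov_def)

lemma krylov_mono: "l \<le> m \<Longrightarrow> krylov T v l \<subseteq> krylov T v m"
  unfolding krylov_def by (intro span_mono image_mono) auto

lemma krylov_start: "v \<in> krylov T v (Suc l)"
  unfolding krylov_def by (rule span_base) (force intro: image_eqI[of _ _ 0])

lemma krylov_linear_image:
  assumes "linear f" and "\<And>j. j < l \<Longrightarrow> f ((((*v) T) ^^ j) v) \<in> U"
    and "subspace U" and "w \<in> krylov T v l"
  shows "f w \<in> U"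
proof -
  have "f w \<in> f ` span ((\<lambda>j. (((*v) T) ^^ j) v) ` {..<l})"
    using assms(4) by (auto simp: krylov_def)
  also have "\<dots> = span (f ` (\<lambda>j. (((*v) T) ^^ j) v) ` {..<l})"
    using linear_span_image[OF assms(1)] by blast
  also have "\<dots> \<subseteq> U"
    using assms(2,3) by (intro span_minimal) auto
  finally show ?thesis .
qed

lemma krylov_power: "j < l \<Longrightarrow> (((*v) T) ^^ j) v \<in> krylov T v l"
  unfolding krylov_def by (rule span_base) auto

lemma krylov_step: "w \<in> krylov T v l \<Longrightarrow> T *v w \<in> krylov T v (Suc l)"
proof (rule krylov_linear_image[where f = "(*v) T" and l = l and T = T and v = v])
  show "T *v (((*v) T) ^^ j) v \<in> krylov T v (Suc l)" if "j < l" for j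
    using krylov_power[of "Suc j" "Suc l" T v] that by simp
qed (simp_all add: subspace_krylov)

text \<open>
  \<open>Q T = T' Q\<close> implies \<open>Q q(T) = q(T') Q\<close> for every polynomial \<open>q\<close>. This transfers approximations
  from one method to the other.
\<close>

lemma krylov_intertwine:
  assumes "Q ** T = T' ** Q" and "w \<in> krylov T v l"
  shows "Q *v w \<in> krylov T' (Q *v v) l"
proof (rule krylov_linear_image[OF _ _ subspace_krylov assms(2)])
  fix j assume "j < l"
  have "Q *v (((*v) T) ^^ j) v = (((*v) T') ^^ j) (Q *v v)"
  proof (induction j)
    case (Suc j)
    have "Q *v (T *v u) = T' *v (Q *v u)" for u
      using assms(1) by (simp add: matrix_vector_mul_assoc)
    then show ?case using Suc by simp
  qed simp
  then show "Q *v (((*v) T) ^^ j) v \<in> krylov T' (Q *v v) l"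
    using krylov_power[OF \<open>j < l\<close>] by simp
qed simp

text \<open>
  \<open>q(T) (1 - c T) v\<close> is a polynomial in \<open>T\<close> of one degree more, applied to \<open>v\<close>.
\<close>

lemma krylov_one_minus:
  "krylov T (v - c *\<^sub>R (T *v v)) l \<subseteq> krylov T v (Suc l)"
proof -
  have shifted: "(((*v) T) ^^ j) (v - c *\<^sub>R (T *v v))
      = (((*v) T) ^^ j) v - c *\<^sub>R (((*v) T) ^^ Suc j) v" for j
    by (induction j) (simp_all add: matrix_vector_mult_diff_distrib matrix_vector_mult_scaleR)
  show ?thesis
    unfolding krylov_def[of T "v - _"] shifted
    by (intro span_minimal subspace_krylov image_subsetI subspace_diff subspace_scale krylov_power)
       auto
qed

section \<open>Optimality of preconditioned conjugate gradients\<close>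

lemma symmetric_inner:
  fixes M :: "real^'n^'n"
  assumes "transpose M = M"
  shows "(M *v x) \<bullet> y = x \<bullet> (M *v y)"
  by (metis assms dot_lmul_matrix transpose_matrix_vector)

text \<open>
  If \<open>u \<bullet> M p\<close> were nonzero, the quadratic form would be affine and nonconstant along the line
  \<open>u + t p\<close>, hence negative somewhere; the \<open>t\<close> in the proof gives it the value \<open>-1\<close>.
\<close>

lemma psd_null_vector:
  fixes M :: "real^'n^'n"
  assumes sym: "transpose M = M" and psd: "\<And>x. 0 \<le> x \<bullet> (M *v x)"
    and p: "p \<bullet> (M *v p) = 0"
  shows "u \<bullet> (M *v p) = 0"
proof (rule ccontr)
  assume ne: "u \<bullet> (M *v p) \<noteq> 0"
  define t where "t = - (u \<bullet> (M *v u) + 1) / (2 * (u \<bullet> (M *v p)))"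
  have "p \<bullet> (M *v u) = u \<bullet> (M *v p)"
    using symmetric_inner[OF sym, of p u] by (simp add: inner_commute)
  then have "(u + t *\<^sub>R p) \<bullet> (M *v (u + t *\<^sub>R p)) = u \<bullet> (M *v u) + 2 * t * (u \<bullet> (M *v p))"
    using p by (simp add: algebra_simps inner_add_left inner_add_right matrix_vector_mult_scaleR)
  also have "\<dots> = -1"
    using ne by (simp add: t_def field_simps)
  finally show False
    using psd[of "u + t *\<^sub>R p"] by simp
qed

definition pcg_rho where
  "pcg_rho M c F x0 l = pcg_r M c F x0 l \<bullet> (F *v pcg_r M c F x0 l)"

definition pcg_alpha where
  "pcg_alpha M c F x0 l =
     pcg_rho M c F x0 l / ((M *v pcg_p M c F x0 l) \<bullet> pcg_p M c F x0 l)"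

lemma pcg_0:
  "pcg_x M c F x0 0 = x0" "pcg_r M c F x0 0 = c - M *v x0"
  "pcg_p M c F x0 0 = F *v pcg_r M c F x0 0"
  by (simp_all add: pcg_x_def pcg_r_def pcg_p_def)

lemma pcg_Suc:
  "pcg_x M c F x0 (Suc l) = pcg_x M c F x0 l + pcg_alpha M c F x0 l *\<^sub>R pcg_p M c F x0 l"
  "pcg_r M c F x0 (Suc l) = pcg_r M c F x0 l - pcg_alpha M c F x0 l *\<^sub>R (M *v pcg_p M c F x0 l)"
  "pcg_p M c F x0 (Suc l) = F *v pcg_r M c F x0 (Suc l)
     + (pcg_rho M c F x0 (Suc l) / pcg_rho M c F x0 l) *\<^sub>R pcg_p M c F x0 l"
  by (simp_all add: pcg_x_def pcg_r_def pcg_p_def pcg_alpha_def pcg_rho_def Let_def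
      split: prod.splits)

lemma pcg_residual: "pcg_r M c F x0 l = c - M *v pcg_x M c F x0 l"
  by (induction l)
     (simp_all add: pcg_0 pcg_Suc matrix_vector_right_distrib matrix_vector_mult_scaleR)

text \<open>
  The search direction gains one order through the new preconditioned residual, which is
  \<open>F r\<^sub>0 - F M (x - x0)\<close>. This form never divides by a step length, so the result also holds after a
  breakdown.
\<close>

lemma pcg_in_krylov:
  "pcg_x M c F x0 l - x0 \<in> krylov (F ** M) (F *v (c - M *v x0)) l
   \<and> pcg_p M c F x0 l \<in> krylov (F ** M) (F *v (c - M *v x0)) (Suc l)"
proof (induction l)
  case 0
  then show ?case
    by (simp add: pcg_0 subspace_0[OF subspace_krylov] krylov_start)
next
  case (Suc l)
  let ?K = "krylov (F ** M) (F *v (c - M *v x0))"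
  let ?x = "pcg_x M c F x0" and ?p = "pcg_p M c F x0"
  note sub = subspace_krylov[of "F ** M" "F *v (c - M *v x0)"]
  have "(?x l - x0) + pcg_alpha M c F x0 l *\<^sub>R ?p l \<in> ?K (Suc l)"
    using Suc krylov_mono[of l "Suc l"]
    by (intro subspace_add[OF sub] subspace_scale[OF sub]) auto
  then have x: "?x (Suc l) - x0 \<in> ?K (Suc l)"
    by (simp add: pcg_Suc algebra_simps)
  have "F *v pcg_r M c F x0 (Suc l) = F *v (c - M *v x0) - (F ** M) *v (?x (Suc l) - x0)"
    by (simp add: pcg_residual matrix_vector_mul_assoc[symmetric]
        matrix_vector_mult_diff_distrib)
  also have "\<dots> \<in> ?K (Suc (Suc l))"
    by (intro subspace_diff[OF sub] krylov_start krylov_step[OF x])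
  finally have "?p (Suc l) \<in> ?K (Suc (Suc l))"
    unfolding pcg_Suc(3) using Suc krylov_mono[of "Suc l" "Suc (Suc l)"]
    by (intro subspace_add[OF sub] subspace_scale[OF sub]) auto
  with x show ?case by blast
qed

text \<open>
  Conjugacy is a statement about search directions and optimality one about Krylov spaces. The span
  of the directions mediates: as long as the step lengths do not vanish it contains the Krylov
  space of the same order (\<open>krylov_subset_pcg_dirs\<close>).
\<close>

definition pcg_dirs where
  "pcg_dirs M c F x0 l = span (pcg_p M c F x0 ` {..<l})"

lemma pcg_p_in_dirs: "i < l \<Longrightarrow> pcg_p M c F x0 i \<in> pcg_dirs M c F x0 l"
  unfolding pcg_dirs_def by (rule span_base) auto

lemma subspace_pcg_dirs: "subspace (pcg_dirs M c F x0 l)"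
  by (simp add: pcg_dirs_def)

lemma pcg_dirs_orthogonal:
  assumes "\<And>i. i < l \<Longrightarrow> u \<bullet> pcg_p M c F x0 i = 0" and "w \<in> pcg_dirs M c F x0 l"
  shows "u \<bullet> w = 0"
  using assms(2) unfolding pcg_dirs_def
proof (induction rule: span_induct_alt)
  case base
  then show ?case by simp
next
  case (step a y z)
  then show ?case using assms(1) by (auto simp: inner_add_right)
qed

lemma pcg_z_in_dirs: "j < l \<Longrightarrow> F *v pcg_r M c F x0 j \<in> pcg_dirs M c F x0 l"
proof (cases j)
  case (Suc m)
  assume "j < l"
  have "F *v pcg_r M c F x0 j = pcg_p M c F x0 (Suc m)
     - (pcg_rho M c F x0 (Suc m) / pcg_rho M c F x0 m) *\<^sub>R pcg_p M c F x0 m"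
    by (simp add: pcg_Suc(3) Suc)
  also have "\<dots> \<in> pcg_dirs M c F x0 l"
    using \<open>j < l\<close> Suc
    by (intro subspace_diff subspace_scale subspace_pcg_dirs pcg_p_in_dirs) auto
  finally show ?thesis .
qed (use pcg_p_in_dirs[of 0 l M c F x0] in \<open>simp add: pcg_0\<close>)

text \<open>
  The residual update, read from right to left: when the step length is nonzero, it expresses
  \<open>F M p\<^sub>j\<close> by preconditioned residuals, which lie in the span of the directions.
\<close>

lemma pcg_scaled_step:
  "pcg_alpha M c F x0 j *\<^sub>R ((F ** M) *v pcg_p M c F x0 j)
     = F *v pcg_r M c F x0 j - F *v pcg_r M c F x0 (Suc j)"
  by (simp add: pcg_Suc(2) matrix_vector_mult_diff_distrib matrix_vector_mult_scaleR
      matrix_vector_mul_assoc)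

lemma pcg_step_in_dirs:
  assumes "pcg_alpha M c F x0 j \<noteq> 0" and "Suc j < l"
  shows "(F ** M) *v pcg_p M c F x0 j \<in> pcg_dirs M c F x0 l"
proof -
  have "(F ** M) *v pcg_p M c F x0 j
      = (1 / pcg_alpha M c F x0 j) *\<^sub>R (F *v pcg_r M c F x0 j - F *v pcg_r M c F x0 (Suc j))"
    using assms(1) by (simp flip: pcg_scaled_step)
  also have "\<dots> \<in> pcg_dirs M c F x0 l"
    using assms(2) by (intro subspace_scale subspace_diff subspace_pcg_dirs pcg_z_in_dirs) auto
  finally show ?thesis .
qed

lemma krylov_subset_pcg_dirs:
  assumes "\<And>j. Suc j < l \<Longrightarrow> pcg_alpha M c F x0 j \<noteq> 0"
  shows "krylov (F ** M) (F *v (c - M *v x0)) l \<subseteq> pcg_dirs M c F x0 l"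
proof -
  let ?v = "F *v (c - M *v x0)"
  have "j < l \<Longrightarrow> (((*v) (F ** M)) ^^ j) ?v \<in> pcg_dirs M c F x0 (Suc j)" for j
  proof (induction j)
    case 0
    then show ?case
      using pcg_p_in_dirs[of 0 "Suc 0" M c F x0] by (simp add: pcg_0)
  next
    case (Suc j)
    have "(F ** M) *v w \<in> pcg_dirs M c F x0 (Suc (Suc j))"
      if "w \<in> pcg_dirs M c F x0 (Suc j)" for w
      using that unfolding pcg_dirs_def[of _ _ _ _ "Suc j"]
    proof (induction rule: span_induct_alt)
      case base
      then show ?case by (simp add: subspace_0 subspace_pcg_dirs)
    next
      case (step a y z)
      then obtain i where i: "i < Suc j" "y = pcg_p M c F x0 i" by auto
      with Suc.prems have "(F ** M) *v y \<in> pcg_dirs M c F x0 (Suc (Suc j))"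
        by (auto intro!: pcg_step_in_dirs assms)
      then show ?case
        using step unfolding matrix_vector_right_distrib matrix_vector_mult_scaleR
        by (intro subspace_add subspace_scale subspace_pcg_dirs)
    qed
    then show ?case using Suc by simp
  qed
  moreover have "pcg_dirs M c F x0 (Suc j) \<subseteq> pcg_dirs M c F x0 l" if "j < l" for j
    using that unfolding pcg_dirs_def by (intro span_mono image_mono) auto
  ultimately show ?thesis
    unfolding krylov_def by (intro span_minimal subspace_pcg_dirs) blast
qed

text \<open>
  The classical orthogonality relations, proved together by induction, for a semidefinite \<open>M\<close>. A
  step cannot break down at a nonzero residual: \<open>p \<bullet> M p = 0\<close> would give \<open>M p = 0\<close>, while
  \<open>p \<bullet> r = r \<bullet> F r > 0\<close> and \<open>r = M (xs - x)\<close> lies in the range of \<open>M\<close>, which is orthogonal to its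
  kernel. Consistency of the system is what makes this work.
\<close>

lemma pcg_orthogonality:
  fixes M F :: "real^'n^'n" and xs x0 :: "real^'n"
  defines "r \<equiv> pcg_r M (M *v xs) F x0" and "p \<equiv> pcg_p M (M *v xs) F x0"
    and "\<alpha> \<equiv> pcg_alpha M (M *v xs) F x0"
  assumes sym: "transpose M = M" and psd: "\<And>x. 0 \<le> x \<bullet> (M *v x)" and F: "spd F"
    and ne: "\<And>j. j < l \<Longrightarrow> r j \<noteq> 0"
  shows "(\<forall>i<l. r l \<bullet> p i = 0) \<and> (\<forall>i<l. (M *v p l) \<bullet> p i = 0) \<and>
    r l \<bullet> p l = r l \<bullet> (F *v r l) \<and> (\<forall>i<l. \<alpha> i \<noteq> 0)"
  using ne
proof (induction l)
  case 0
  then show ?case by (simp add: r_def p_def pcg_0)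
next
  case (Suc l)
  define \<rho> where "\<rho> = pcg_rho M (M *v xs) F x0"
  have rho: "\<rho> j = r j \<bullet> (F *v r j)" for j
    by (simp add: \<rho>_def r_def pcg_rho_def)
  have IH: "\<And>i. i < l \<Longrightarrow> r l \<bullet> p i = 0" "\<And>i. i < l \<Longrightarrow> (M *v p l) \<bullet> p i = 0"
    "r l \<bullet> p l = \<rho> l" "\<And>i. i < l \<Longrightarrow> \<alpha> i \<noteq> 0"
    using Suc unfolding rho by auto
  have rs: "r (Suc l) = r l - \<alpha> l *\<^sub>R (M *v p l)"
    and ps: "p (Suc l) = F *v r (Suc l) + (\<rho> (Suc l) / \<rho> l) *\<^sub>R p l"
    and al: "\<alpha> l = \<rho> l / ((M *v p l) \<bullet> p l)"
    by (simp_all add: r_def p_def \<alpha>_def \<rho>_def pcg_Suc pcg_alpha_def)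
  have rho_pos: "\<rho> l > 0"
    using Suc.prems[of l] F by (simp add: rho spd_def)
  have denom: "(M *v p l) \<bullet> p l \<noteq> 0"
  proof
    assume "(M *v p l) \<bullet> p l = 0"
    then have "(xs - pcg_x M (M *v xs) F x0 l) \<bullet> (M *v p l) = 0"
      using psd_null_vector[OF sym psd, of "p l"] by (metis inner_commute)
    moreover have "r l = M *v (xs - pcg_x M (M *v xs) F x0 l)"
      by (simp add: r_def pcg_residual matrix_vector_mult_diff_distrib)
    ultimately show False
      using IH(3) rho_pos symmetric_inner[OF sym] by simp
  qed
  then have al0: "\<alpha> l \<noteq> 0"
    using rho_pos by (simp add: al)
  then have alphas: "\<alpha> i \<noteq> 0" if "i < Suc l" for i
    using IH(4) that less_Suc_eq by auto
  have rp: "r (Suc l) \<bullet> p i = 0" if "i < Suc l" for i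
  proof (cases "i = l")
    case True
    then show ?thesis
      using denom IH(3) by (simp add: rs inner_diff_left al)
  next
    case False
    then show ?thesis
      using that IH by (simp add: rs inner_diff_left)
  qed
  have rdirs: "r (Suc l) \<bullet> w = 0" if "w \<in> pcg_dirs M (M *v xs) F x0 (Suc l)" for w
    using pcg_dirs_orthogonal[OF _ that, of "r (Suc l)"] rp by (simp add: p_def)
  have Fsym: "transpose F = F"
    using F by (simp add: spd_def)
  \<comment> \<open>Conjugacy to the earlier directions reduces to orthogonality of the new residual to
    \<open>F M p\<^sub>i\<close>, which for \<open>i < l\<close> stays inside the span of the directions up to \<open>l\<close>.\<close>
  have swap: "(M *v (F *v r (Suc l))) \<bullet> p i = r (Suc l) \<bullet> ((F ** M) *v p i)" for i
    by (simp add: symmetric_inner[OF sym] symmetric_inner[OF Fsym]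
        flip: matrix_vector_mul_assoc)
  have Mp: "(M *v p (Suc l)) \<bullet> p i = r (Suc l) \<bullet> ((F ** M) *v p i)
      + (\<rho> (Suc l) / \<rho> l) * ((M *v p l) \<bullet> p i)" for i
    by (simp only: ps matrix_vector_right_distrib matrix_vector_mult_scaleR
        inner_add_left inner_scaleR_left swap)
  have pp: "(M *v p (Suc l)) \<bullet> p i = 0" if "i < Suc l" for i
  proof (cases "i = l")
    case True
    have "\<alpha> l * (r (Suc l) \<bullet> ((F ** M) *v p l)) = r (Suc l) \<bullet> (F *v r l) - \<rho> (Suc l)"
      using pcg_scaled_step[of M "M *v xs" F x0 l]
      by (simp add: rho inner_diff_right[symmetric] r_def \<alpha>_def p_def flip: inner_scaleR_right)
    moreover have "r (Suc l) \<bullet> (F *v r l) = 0"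
      unfolding r_def by (rule rdirs[unfolded r_def]) (simp add: pcg_z_in_dirs)
    ultimately have "r (Suc l) \<bullet> ((F ** M) *v p l) = - \<rho> (Suc l) / \<alpha> l"
      using al0 by (simp add: field_simps)
    then show ?thesis
      using denom rho_pos by (simp add: Mp True al)
  next
    case False
    then have "i < l" using that by simp
    then have "(F ** M) *v p i \<in> pcg_dirs M (M *v xs) F x0 (Suc l)"
      unfolding p_def using alphas[of i] by (intro pcg_step_in_dirs) (auto simp: \<alpha>_def)
    then show ?thesis
      using IH(2)[OF \<open>i < l\<close>] by (simp add: Mp rdirs)
  qed
  have "r (Suc l) \<bullet> p (Suc l) = r (Suc l) \<bullet> (F *v r (Suc l))"
    using rp[of l] by (simp add: ps inner_add_right)
  with rp pp alphas show ?case by blast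
qed

text \<open>
  The residual \<open>M (xs - x)\<close> is orthogonal to the difference of \<open>x\<close> and any competitor, so
  Pythagoras applies to the \<open>M\<close>-seminorm. If instead some residual has vanished, the iteration
  stays where it is and the seminorm of the error is \<open>0\<close>. The convention \<open>0 / 0 = 0\<close> thus makes the
  result hold for every \<open>l\<close>.
\<close>

lemma pcg_optimal:
  fixes M F :: "real^'n^'n" and xs x0 d :: "real^'n"
  assumes sym: "transpose M = M" and psd: "\<And>x. 0 \<le> x \<bullet> (M *v x)" and F: "spd F"
    and d: "d \<in> krylov (F ** M) (F *v (M *v xs - M *v x0)) l"
  shows "anorm M (xs - pcg_x M (M *v xs) F x0 l) \<le> anorm M (xs - (x0 + d))"
proof -
  define x where "x = pcg_x M (M *v xs) F x0 l"
  have r: "pcg_r M (M *v xs) F x0 l = M *v (xs - x)"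
    by (simp add: x_def pcg_residual matrix_vector_mult_diff_distrib)
  have stop: "pcg_r M (M *v xs) F x0 (j + i) = 0" if "pcg_r M (M *v xs) F x0 j = 0" for i j
    using that by (induction i) (simp_all add: pcg_stops)
  show ?thesis
  proof (cases "\<exists>j\<le>l. pcg_r M (M *v xs) F x0 j = 0")
    case True
    then have "M *v (xs - x) = 0"
      using stop r by (metis le_add_diff_inverse)
    then show ?thesis
      using psd by (simp add: anorm_def x_def)
  next
    case False
    note orth = pcg_orthogonality[OF sym psd F, of l xs x0]
    have "d - (x - x0) \<in> krylov (F ** M) (F *v (M *v xs - M *v x0)) l"
      using d pcg_in_krylov[of M "M *v xs" F x0 l] unfolding x_def
      by (intro subspace_diff[OF subspace_krylov d]) blast
    then have "d - (x - x0) \<in> pcg_dirs M (M *v xs) F x0 l"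
      using krylov_subset_pcg_dirs[of l M "M *v xs" F x0] orth False by auto
    then have "(M *v (xs - x)) \<bullet> (d - (x - x0)) = 0"
      using pcg_dirs_orthogonal[of l "M *v (xs - x)"] orth False r by (metis less_imp_le)
    then have orth': "(xs - x) \<bullet> (M *v (d - (x - x0))) = 0"
      using symmetric_inner[OF sym] by simp
    define u w where "u = xs - x" and "w = d - (x - x0)"
    have "(u - w) \<bullet> (M *v (u - w)) = u \<bullet> (M *v u) + w \<bullet> (M *v w)"
      using orth' symmetric_inner[OF sym, of w u]
      by (simp add: u_def[symmetric] w_def[symmetric] matrix_vector_mult_diff_distrib
          inner_diff_left inner_diff_right inner_commute)
    moreover have "xs - (x0 + d) = u - w"
      by (simp add: u_def w_def)
    ultimately show ?thesis
      using psd[of w] by (simp add: anorm_def x_def[symmetric] u_def[symmetric])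
  qed
qed

section \<open>Matrices with a common orthonormal eigenbasis\<close>

definition spec_mat :: "'a set \<Rightarrow> ('a \<Rightarrow> real^'n) \<Rightarrow> ('a \<Rightarrow> real) \<Rightarrow> real^'n^'n" where
  "spec_mat I s f = (\<Sum>i\<in>I. f i *\<^sub>R outer (s i))"

definition orthonormal_on :: "'a set \<Rightarrow> ('a \<Rightarrow> real^'n) \<Rightarrow> bool" where
  "orthonormal_on I s \<longleftrightarrow> (\<forall>i\<in>I. \<forall>j\<in>I. s i \<bullet> s j = (if i = j then 1 else 0))"

lemma outer_nth: "outer v $ a $ b = v $ a * v $ b"
  by (simp add: outer_def matrix_matrix_mult_def columnvector_def rowvector_def)

lemma outer_mult_vector: "outer v *v x = (v \<bullet> x) *\<^sub>R v"
  by (simp add: vec_eq_iff matrix_vector_mult_def outer_nth inner_vec_def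
      sum_distrib_right sum_distrib_left mult_ac)

lemma sum_matrix_vector: "(\<Sum>i\<in>I. B i) *v x = (\<Sum>i\<in>I. (B i :: real^'n^'m) *v x)"
  by (induction I rule: infinite_finite_induct) (simp_all add: matrix_vector_mult_add_rdistrib)

lemma spec_mat_vector: "spec_mat I s f *v x = (\<Sum>i\<in>I. (f i * (s i \<bullet> x)) *\<^sub>R s i)"
  by (simp add: spec_mat_def sum_matrix_vector scaleR_matrix_vector_assoc[symmetric]
      outer_mult_vector)

lemma transpose_spec_mat: "transpose (spec_mat I s f) = spec_mat I s f"
  by (simp add: vec_eq_iff transpose_def spec_mat_def outer_nth mult_ac)

lemma spec_mat_quadratic: "x \<bullet> (spec_mat I s f *v x) = (\<Sum>i\<in>I. f i * (s i \<bullet> x)\<^sup>2)"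
  by (simp add: spec_mat_vector inner_sum_right power2_eq_square inner_commute mult_ac)

lemma spec_mat_inner:
  assumes "finite I" "orthonormal_on I s" "j \<in> I"
  shows "s j \<bullet> (spec_mat I s f *v x) = f j * (s j \<bullet> x)"
proof -
  have "s j \<bullet> (spec_mat I s f *v x) = (\<Sum>i\<in>I. if i = j then f j * (s j \<bullet> x) else 0)"
    using assms(2,3)
    by (auto simp: spec_mat_vector inner_sum_right orthonormal_on_def intro!: sum.cong)
  then show ?thesis using assms by simp
qed

lemma spec_mat_mult:
  assumes "finite I" "orthonormal_on I s"
  shows "spec_mat I s f ** spec_mat I s g = spec_mat I s (\<lambda>i. f i * g i)"
proof -
  have "(spec_mat I s f ** spec_mat I s g) *v x = spec_mat I s (\<lambda>i. f i * g i) *v x" for x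
    unfolding matrix_vector_mul_assoc[symmetric]
    by (simp add: spec_mat_vector[of _ _ f] spec_mat_inner[OF assms])
       (simp add: spec_mat_vector mult_ac)
  then show ?thesis by (simp add: matrix_eq)
qed

lemma spec_mat_diff:
  "spec_mat I s f - spec_mat I s g = spec_mat I s (\<lambda>i. f i - g i)"
  by (simp add: spec_mat_def sum_subtractf scaleR_diff_left)

lemma spec_mat_add:
  "spec_mat I s f + spec_mat I s g = spec_mat I s (\<lambda>i. f i + g i)"
  by (simp add: spec_mat_def sum.distrib scaleR_add_left)

lemma spec_mat_scaleR: "c *\<^sub>R spec_mat I s f = spec_mat I s (\<lambda>i. c * f i)"
  by (simp add: spec_mat_def scaleR_sum_right)

lemma spec_mat_subset:
  assumes "finite I" "J \<subseteq> I"
  shows "spec_mat J s f = spec_mat I s (\<lambda>i. if i \<in> J then f i else 0)"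
  unfolding spec_mat_def using assms
  by (intro sum.mono_neutral_cong_left) auto

lemma spec_mat_cong: "(\<And>i. i \<in> I \<Longrightarrow> f i = g i) \<Longrightarrow> spec_mat I s f = spec_mat I s g"
  by (simp add: spec_mat_def)

text \<open>
  The sum over \<open>f i * (s i \<bullet> x)\<^sup>2\<close> vanishes only when all coordinates \<open>s i \<bullet> x\<close> do, and the
  resolution of the identity then forces \<open>x = 0\<close>.
\<close>

lemma spd_spec_mat:
  assumes "finite I" "spec_mat I s (\<lambda>_. 1) = mat 1" "\<And>i. i \<in> I \<Longrightarrow> f i > 0"
  shows "spd (spec_mat I s f)"
  unfolding spd_def
proof (intro conjI allI impI transpose_spec_mat)
  fix x :: "real^'b" assume "x \<noteq> 0"
  have "\<exists>i\<in>I. s i \<bullet> x \<noteq> 0"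
  proof (rule ccontr)
    assume "\<not> ?thesis"
    then have "spec_mat I s (\<lambda>_. 1) *v x = 0"
      by (simp add: spec_mat_vector)
    then show False using assms(2) \<open>x \<noteq> 0\<close> by simp
  qed
  then obtain i where "i \<in> I" "s i \<bullet> x \<noteq> 0" by blast
  then show "0 < x \<bullet> (spec_mat I s f *v x)"
    unfolding spec_mat_quadratic using assms(1,3)
    by (intro sum_pos2[of _ i]) (auto simp: less_imp_le)
qed

lemma spec_mat_of_decomposition:
  fixes S :: "real^'n^'n"
  assumes e: "bij_betw e {1..CARD('n)} UNIV"
  shows "S ** diag_mat e f ** transpose S = spec_mat {1..CARD('n)} (\<lambda>i. column (e i) S) f"
proof -
  have inj: "inj_on e {1..CARD('n)}"
    using e by (rule bij_betw_imp_inj_on)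
  let ?d = "\<lambda>c. f (inv_into {1..CARD('n)} e c)"
  have "(S ** diag_mat e f) $ a $ c = S $ a $ c * ?d c" for a c
    by (simp add: matrix_matrix_mult_def diag_mat_def if_distrib cong: if_cong)
  then have "(S ** diag_mat e f ** transpose S) $ a $ b
      = (\<Sum>c\<in>UNIV. S $ a $ c * ?d c * S $ b $ c)" for a b
    by (simp add: matrix_matrix_mult_def[of "S ** diag_mat e f"] transpose_def)
  also have "(\<Sum>c\<in>UNIV. S $ a $ c * ?d c * S $ b $ c)
      = (\<Sum>i\<in>{1..CARD('n)}. S $ a $ e i * ?d (e i) * S $ b $ e i)" for a b
    by (rule sum.reindex_bij_betw[OF e, symmetric])
  also have "\<dots> a b = spec_mat {1..CARD('n)} (\<lambda>i. column (e i) S) f $ a $ b" for a b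
    unfolding spec_mat_def sum_component vector_scaleR_component outer_nth column_def
    by (intro sum.cong refl) (simp add: inv_into_f_f[OF inj] mult_ac del: One_nat_def)
  finally show ?thesis by (simp add: vec_eq_iff)
qed

lemma orthonormal_columns:
  fixes S :: "real^'n^'n"
  assumes e: "bij_betw e {1..CARD('n)} UNIV" and S: "orthogonal_matrix S"
  shows "orthonormal_on {1..CARD('n)} (\<lambda>i. column (e i) S)"
proof -
  have "column a S \<bullet> column b S = (transpose S ** S) $ a $ b" for a b
    by (simp add: matrix_matrix_mult_def transpose_def inner_vec_def column_def)
  also have "\<dots> a b = (if a = b then 1 else 0)" for a b
    using S by (simp add: orthogonal_matrix_def mat_def)
  finally show ?thesis
    using bij_betw_imp_inj_on[OF e] by (auto simp: orthonormal_on_def dest: inj_onD)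
qed

lemma spec_mat_one:
  fixes S :: "real^'n^'n"
  assumes "bij_betw e {1..CARD('n)} UNIV" and "orthogonal_matrix S"
  shows "spec_mat {1..CARD('n)} (\<lambda>i. column (e i) S) (\<lambda>_. 1) = mat 1"
proof -
  have "diag_mat e (\<lambda>_. 1) = (mat 1 :: real^'n^'n)"
    by (simp add: diag_mat_def mat_def)
  then show ?thesis
    using assms spec_mat_of_decomposition[OF assms(1), of S "\<lambda>_. 1"]
    by (simp add: orthogonal_matrix_def)
qed

section \<open>Deflated against shifted conjugate gradients\<close>

lemma anorm_spec_mat:
  assumes "finite I" "orthonormal_on I s"
  shows "anorm (spec_mat I s f) (spec_mat I s g *v w) = sqrt (\<Sum>i\<in>I. f i * (g i * (s i \<bullet> w))\<^sup>2)"
  by (simp add: anorm_def spec_mat_quadratic spec_mat_inner[OF assms])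

text \<open>
  The first summand of the deflated iterate solves the system exactly on the span of \<open>s i\<close> with
  \<open>i \<in> J\<close>: it equals \<open>(1 - P) xs\<close>. Only the projected error of the inner iteration remains.
\<close>

lemma deflated_error:
  assumes I: "finite I" "orthonormal_on I s" "spec_mat I s (\<lambda>_. 1) = mat 1"
    and lam: "\<And>i. i \<in> I \<Longrightarrow> lam i \<noteq> 0" and J: "J \<subseteq> I"
    and A: "A = spec_mat I s lam"
  shows "xs - defl_x A (A *v xs) x0 J lam s l
    = defl_proj J s *v (xs - cg_x (defl_proj J s ** A) (defl_proj J s *v (A *v xs)) x0 l)"
proof -
  have P: "defl_proj J s = mat 1 - spec_mat J s (\<lambda>_. 1)"
    by (simp add: defl_proj_def spec_mat_def)
  have "(\<Sum>i\<in>J. (1 / lam i) *\<^sub>R (outer (s i) *v (A *v xs)))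
      = (spec_mat J s (\<lambda>i. 1 / lam i) ** A) *v xs"
    by (simp add: spec_mat_def sum_matrix_vector scaleR_matrix_vector_assoc
        flip: matrix_vector_mul_assoc)
  also have "spec_mat J s (\<lambda>i. 1 / lam i) ** A = spec_mat J s (\<lambda>_. 1)"
    unfolding A spec_mat_subset[OF I(1) J] spec_mat_mult[OF I(1,2)]
    by (rule spec_mat_cong) (simp add: lam)
  finally show ?thesis
    by (simp add: defl_x_def P matrix_vector_mult_diff_distrib matrix_vector_mult_diff_rdistrib)
qed

text \<open>
  The comparison for an arbitrary set \<open>J\<close> of deflated eigenvectors. Its link between the methods is
  that \<open>P\<close> intertwines \<open>F A\<close> with \<open>P A\<close>, and \<open>G = 1 - F A / \<theta>\<close> intertwines \<open>P A\<close> with \<open>F A\<close>: both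
  annihilate the eigenvectors in \<open>J\<close>, and the two operators agree on the other ones.
\<close>

theorem deflated_shifted_cg:
  fixes s :: "nat \<Rightarrow> real^'n"
  assumes I: "finite I" "orthonormal_on I s" "spec_mat I s (\<lambda>_. 1) = mat 1"
    and lam: "\<And>i. i \<in> I \<Longrightarrow> lam i > 0" and J: "J \<subseteq> I" and \<theta>: "\<theta> > 0"
    and \<alpha>: "\<alpha> \<ge> 0" "\<And>i. i \<in> I - J \<Longrightarrow> \<bar>\<theta> - lam i\<bar> \<le> \<alpha>"
    and A: "A = spec_mat I s lam"
    and F_eq: "F = mat 1 + spec_mat J s (\<lambda>i. \<theta> / lam i - 1)"
  shows "anorm A (xs - defl_x A (A *v xs) x0 J lam s l) \<le> anorm A (xs - pcg_x A (A *v xs) F x0 l)"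
    and "anorm A (xs - pcg_x A (A *v xs) F x0 (Suc l))
      \<le> \<alpha> / \<theta> * anorm A (xs - defl_x A (A *v xs) x0 J lam s l)"
proof -
  note mult = spec_mat_mult[OF I(1,2)] and norm = anorm_spec_mat[OF I(1,2)]
  have lam0: "lam i \<noteq> 0" if "i \<in> I" for i
    using lam[OF that] by simp
  define P where "P = defl_proj J s"
  have P: "P = spec_mat I s (\<lambda>i. if i \<in> J then 0 else 1)"
    unfolding P_def defl_proj_def I(3)[symmetric] spec_mat_diff
    using spec_mat_subset[OF I(1) J, of s "\<lambda>_. 1"]
    by (simp add: spec_mat_def[of J] spec_mat_diff) (rule spec_mat_cong, simp)
  have F: "F = spec_mat I s (\<lambda>i. if i \<in> J then \<theta> / lam i else 1)"
    unfolding F_eq spec_mat_subset[OF I(1) J] I(3)[symmetric] spec_mat_add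
    by (rule spec_mat_cong) simp
  have FA: "F ** A = spec_mat I s (\<lambda>i. if i \<in> J then \<theta> else lam i)"
    unfolding F A mult using lam0 by (intro spec_mat_cong) auto
  have PA: "P ** A = spec_mat I s (\<lambda>i. if i \<in> J then 0 else lam i)"
    unfolding P A mult by (rule spec_mat_cong) simp
  define G where "G = spec_mat I s (\<lambda>i. if i \<in> J then 0 else 1 - lam i / \<theta>)"
  have G: "G = mat 1 - (1 / \<theta>) *\<^sub>R (F ** A)"
    unfolding G_def FA I(3)[symmetric] spec_mat_scaleR spec_mat_diff
    using \<theta> by (intro spec_mat_cong) simp
  have GP: "G ** P = G" and comm: "P ** (F ** A) = (P ** A) ** P" "G ** (P ** A) = (F ** A) ** G"
    "(F ** A) ** G = G ** (F ** A)" and PF: "P ** F = P"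
    unfolding G_def FA PA unfolding P F mult by (rule spec_mat_cong; simp)+
  have spdF: "spd F" and spdA: "spd A"
    unfolding F A using lam \<theta> by (auto intro!: spd_spec_mat[OF I(1,3)])
  have psdA: "0 \<le> v \<bullet> (A *v v)" for v
    using spdA by (cases "v = 0") (auto simp: spd_def less_imp_le)
  have symA: "transpose A = A"
    using spdA by (simp add: spd_def)
  have psdPA: "0 \<le> v \<bullet> ((P ** A) *v v)" for v
    unfolding PA spec_mat_quadratic using lam by (auto intro!: sum_nonneg simp: less_imp_le)
  have symPA: "transpose (P ** A) = P ** A"
    by (simp add: PA transpose_spec_mat)
  have spd1: "spd (mat 1 :: real^'n^'n)"
    by (simp add: spd_def)
  have anormPA: "anorm (P ** A) w = anorm A (P *v w)" for w
    unfolding norm[of lam "\<lambda>i. if i \<in> J then 0 else 1", folded P A]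
    by (auto simp: anorm_def PA spec_mat_quadratic intro!: sum.cong)
  define z where "z = pcg_x (P ** A) ((P ** A) *v xs) (mat 1) x0"
  have defl: "anorm A (xs - defl_x A (A *v xs) x0 J lam s m) = anorm (P ** A) (xs - z m)" for m
    using deflated_error[OF I lam0 J A, of xs x0 m]
    by (simp add: anormPA P_def[symmetric] z_def cg_x_def matrix_vector_mul_assoc)
  define e0 where "e0 = xs - x0"
  have z_opt: "anorm (P ** A) (xs - z m) \<le> anorm (P ** A) (xs - (x0 + d))"
    if "d \<in> krylov (P ** A) ((P ** A) *v e0) m" for d m
    unfolding z_def using that
    by (intro pcg_optimal[OF symPA psdPA spd1])
       (simp add: e0_def matrix_vector_mult_diff_distrib)
  have x_opt: "anorm A (xs - pcg_x A (A *v xs) F x0 m) \<le> anorm A (xs - (x0 + d))"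
    if "d \<in> krylov (F ** A) ((F ** A) *v e0) m" for d m
    using that
    by (intro pcg_optimal[OF symA psdA spdF])
       (simp add: e0_def matrix_vector_mult_diff_distrib flip: matrix_vector_mul_assoc)
  show "anorm A (xs - defl_x A (A *v xs) x0 J lam s l) \<le> anorm A (xs - pcg_x A (A *v xs) F x0 l)"
  proof -
    define x where "x = pcg_x A (A *v xs) F x0 l"
    have "x - x0 \<in> krylov (F ** A) ((F ** A) *v e0) l"
      using pcg_in_krylov[of A "A *v xs" F x0 l]
      by (simp add: x_def e0_def matrix_vector_mult_diff_distrib flip: matrix_vector_mul_assoc)
    then have "P *v (x - x0) \<in> krylov (P ** A) (P *v ((F ** A) *v e0)) l"
      by (rule krylov_intertwine[OF comm(1)])
    moreover have "P *v ((F ** A) *v e0) = (P ** A) *v e0"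
      by (metis PF matrix_mul_assoc matrix_vector_mul_assoc)
    ultimately have "anorm (P ** A) (xs - z l) \<le> anorm (P ** A) (xs - (x0 + P *v (x - x0)))"
      by (intro z_opt) simp
    also have "P *v (xs - (x0 + P *v (x - x0))) = P *v (xs - x)"
    proof -
      have "P ** P = P" unfolding P mult by (rule spec_mat_cong) simp
      then show ?thesis
        by (simp add: matrix_vector_mult_diff_distrib matrix_vector_right_distrib
            matrix_vector_mul_assoc)
    qed
    then have "anorm (P ** A) (xs - (x0 + P *v (x - x0))) = anorm A (P *v (xs - x))"
      by (simp add: anormPA)
    also have "\<dots> \<le> anorm A (xs - x)"
      unfolding norm[of lam "\<lambda>i. if i \<in> J then 0 else 1", folded P A]
      using lam by (auto simp: anorm_def A spec_mat_quadratic less_imp_le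
          intro!: sum_mono)
    finally show ?thesis
      by (simp add: defl x_def)
  qed
  show "anorm A (xs - pcg_x A (A *v xs) F x0 (Suc l))
      \<le> \<alpha> / \<theta> * anorm A (xs - defl_x A (A *v xs) x0 J lam s l)"
  proof -
    \<comment> \<open>The competitor has error \<open>G (xs - z l)\<close>. As \<open>G\<close> vanishes on the eigenvectors in \<open>J\<close>, the
      components of \<open>z l\<close> there, which the deflated method does not control, do not matter.\<close>
    define d where "d = z l - x0"
    let ?K = "krylov (F ** A) ((F ** A) *v e0)"
    have "d \<in> krylov (P ** A) ((P ** A) *v e0) l"
      using pcg_in_krylov[of "P ** A" "(P ** A) *v xs" "mat 1" x0 l]
      by (simp add: d_def z_def e0_def matrix_vector_mult_diff_distrib)
    then have "G *v d \<in> krylov (F ** A) (G *v ((P ** A) *v e0)) l"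
      by (rule krylov_intertwine[OF comm(2)])
    moreover have "G *v ((P ** A) *v e0) = G *v ((F ** A) *v e0)"
      by (metis comm(2,3) matrix_vector_mul_assoc)
    ultimately have Gd: "G *v d \<in> krylov (F ** A) (G *v ((F ** A) *v e0)) l"
      by simp
    have "G *v ((F ** A) *v e0)
        = (F ** A) *v e0 - (1 / \<theta>) *\<^sub>R ((F ** A) *v ((F ** A) *v e0))"
      by (simp add: G matrix_vector_mult_diff_rdistrib scaleR_matrix_vector_assoc)
    then have "G *v d \<in> ?K (Suc l)"
      using Gd krylov_one_minus by fastforce
    then have "(1 / \<theta>) *\<^sub>R ((F ** A) *v e0) + G *v d \<in> ?K (Suc l)"
      by (intro subspace_add subspace_scale subspace_krylov krylov_start)
    then have "anorm A (xs - pcg_x A (A *v xs) F x0 (Suc l))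
        \<le> anorm A (xs - (x0 + ((1 / \<theta>) *\<^sub>R ((F ** A) *v e0) + G *v d)))"
      by (rule x_opt)
    also have "xs - (x0 + ((1 / \<theta>) *\<^sub>R ((F ** A) *v e0) + G *v d)) = G *v (xs - z l)"
    proof -
      have "xs - z l = e0 - d" by (simp add: e0_def d_def)
      moreover have "G *v e0 = e0 - (1 / \<theta>) *\<^sub>R ((F ** A) *v e0)"
        by (simp add: G matrix_vector_mult_diff_rdistrib scaleR_matrix_vector_assoc)
      ultimately show ?thesis
        by (simp add: matrix_vector_mult_diff_distrib) (simp add: e0_def algebra_simps)
    qed
    also have "anorm A (G *v (xs - z l)) \<le> \<alpha> / \<theta> * anorm A (P *v (xs - z l))"
    proof -
      have *: "lam i * ((if i \<in> J then 0 else 1 - lam i / \<theta>) * t)\<^sup>2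
          \<le> (\<alpha> / \<theta>)\<^sup>2 * (lam i * ((if i \<in> J then 0 else 1) * t)\<^sup>2)" if "i \<in> I" for i t
      proof (cases "i \<in> J")
        case False
        have "\<bar>1 - lam i / \<theta>\<bar> = \<bar>\<theta> - lam i\<bar> / \<theta>"
          using \<theta> by (simp add: field_simps abs_if)
        also have "\<dots> \<le> \<alpha> / \<theta>"
          using \<alpha>(2)[of i] that False \<theta> by (simp add: divide_right_mono)
        finally have "\<bar>1 - lam i / \<theta>\<bar> \<le> \<bar>\<alpha> / \<theta>\<bar>"
          using \<theta> \<alpha>(1) by simp
        then have "(1 - lam i / \<theta>)\<^sup>2 \<le> (\<alpha> / \<theta>)\<^sup>2"
          by (simp only: abs_le_square_iff)
        then have "(1 - lam i / \<theta>)\<^sup>2 * (lam i * t\<^sup>2) \<le> (\<alpha> / \<theta>)\<^sup>2 * (lam i * t\<^sup>2)"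
          using lam[OF that] by (intro mult_right_mono) auto
        then show ?thesis
          using False by (simp add: power_mult_distrib mult_ac)
      qed simp
      have "anorm A (G *v w) \<le> sqrt ((\<alpha> / \<theta>)\<^sup>2) * anorm A (P *v w)" for w
        unfolding norm[of lam "\<lambda>i. if i \<in> J then 0 else 1", folded P A]
          norm[of lam "\<lambda>i. if i \<in> J then 0 else 1 - lam i / \<theta>", folded G_def A]
          real_sqrt_mult[symmetric] sum_distrib_left
        by (intro real_sqrt_le_mono sum_mono *)
      then show ?thesis
        using \<theta> \<alpha>(1) by simp
    qed
    finally show ?thesis
      by (simp add: defl anormPA)
  qed
qed

text \<open>
  The complement of \<open>\<pi>\<close> is a block of consecutive indices, so monotonicity of \<open>lam\<close> places the
  remaining eigenvalues between those at its two ends, and \<open>\<bar>\<theta> - lam i\<bar>\<close> is largest at an end.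
\<close>

theorem theorem4p2:
  fixes A S :: "real^'n^'n" and b x0 xstar :: "real^'n"
    and e :: "nat \<Rightarrow> 'n" and lam :: "nat \<Rightarrow> real" and s :: "nat \<Rightarrow> real^'n"
    and n k l j0 :: nat and \<pi> :: "nat set" and \<theta> :: real
  assumes "n = CARD('n)"
    and "bij_betw e {1..n} UNIV"
    and "spd A"
    and "orthogonal_matrix S"
    and "A = S ** diag_mat e lam ** transpose S"
    and "\<And>i j. 1 \<le> i \<Longrightarrow> i \<le> j \<Longrightarrow> j \<le> n \<Longrightarrow> lam j \<le> lam i"
    and "lam n > 0"
    and "\<And>i. s i = column (e i) S"
    and "xstar = matrix_inv A *v b"
    and "1 < k" and "k < n"
    and "is_arg_min (\<lambda>j. lam j / lam (n - k + j - 1)) (\<lambda>j. j \<in> {1..k + 1}) j0"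
    and "\<pi> = pi_a n k j0"
    and "1 \<le> l"
    and "\<And>F. feasible e S k F \<Longrightarrow> pcg_not_reached A b F x0 l"
    and "\<theta> > 0"
  shows "anorm A (xstar - defl_x A b x0 \<pi> lam s l)
           \<le> anorm A (xstar - pcg_x A b (F_theta \<pi> lam s \<theta>) x0 l)
       \<and> anorm A (xstar - pcg_x A b (F_theta \<pi> lam s \<theta>) x0 l)
           \<le> max \<bar>lam j0 - \<theta>\<bar> \<bar>\<theta> - lam (n - k + j0 - 1)\<bar> / \<theta>
              * anorm A (xstar - defl_x A b x0 \<pi> lam s (l - 1))"
proof -
  note n = assms(1) and e = assms(2)[unfolded assms(1)] and decr = assms(6)
  have s: "s = (\<lambda>i. column (e i) S)"
    using assms(8) by blast
  have on: "orthonormal_on {1..n} s"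
    unfolding s n using e assms(4) by (rule orthonormal_columns)
  have one: "spec_mat {1..n} s (\<lambda>_. 1) = mat 1"
    unfolding s n using e assms(4) by (rule spec_mat_one)
  have A: "A = spec_mat {1..n} s lam"
    unfolding s n using spec_mat_of_decomposition[OF e] assms(5) by simp
  have pos: "lam i > 0" if "i \<in> {1..n}" for i
    using decr[of i n] that assms(7) by auto
  have "A ** spec_mat {1..n} s (\<lambda>i. 1 / lam i) = mat 1"
    unfolding A spec_mat_mult[OF finite_atLeastAtMost on] one[symmetric]
    using pos by (intro spec_mat_cong) force
  then have "\<exists>B. A ** B = mat 1 \<and> B ** A = mat 1"
    using matrix_left_right_inverse by blast
  then have "A ** matrix_inv A = mat 1"
    unfolding matrix_inv_def by (rule someI2_ex) blast
  then have b: "b = A *v xstar"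
    by (simp add: assms(9) matrix_vector_mul_assoc)
  have j0: "1 \<le> j0" "j0 \<le> k + 1"
    using assms(12) by (auto simp: is_arg_min_def)
  define \<alpha> where "\<alpha> = max \<bar>lam j0 - \<theta>\<bar> \<bar>\<theta> - lam (n - k + j0 - 1)\<bar>"
  have sub: "\<pi> \<subseteq> {1..n}"
    by (auto simp: assms(13) pi_a_def)
  have bound: "\<bar>\<theta> - lam i\<bar> \<le> \<alpha>" if "i \<in> {1..n} - \<pi>" for i
  proof -
    have i: "j0 \<le> i" "i \<le> n - k + j0 - 1" "i \<le> n"
      using that by (auto simp: assms(13) pi_a_def)
    moreover have "n - k + j0 - 1 \<le> n"
      using j0 assms(11) by linarith
    ultimately have "lam i \<le> lam j0" "lam (n - k + j0 - 1) \<le> lam i"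
      using j0 decr[of j0 i] decr[of i "n - k + j0 - 1"] by auto
    then show ?thesis
      by (auto simp: \<alpha>_def abs_if max_def)
  qed
  have F: "F_theta \<pi> lam s \<theta> = mat 1 + spec_mat \<pi> s (\<lambda>i. \<theta> / lam i - 1)"
    by (simp add: F_theta_def spec_mat_def)
  have "0 \<le> \<alpha>"
    by (simp add: \<alpha>_def)
  note main = deflated_shifted_cg[OF finite_atLeastAtMost on one pos sub assms(16) this bound A F,
      of xstar x0, folded b]
  show ?thesis
    using main(1)[of l] main(2)[of "l - 1"] assms(14) by (simp add: \<alpha>_def)
qed

end
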